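(* Let $P$ be a finite poset with minimum $\hat0$, let $\rho:P\to\mathbb N$ and $m\in\mathbb N$ with $\max_{x\in P}\rho(x)\le m$. Let $(A_1,\dots,A_n)$ be an ordered partition of the atom set $A(P)$ and let $f:\prod_{i=1}^nRT_{\hat U(A_i)}\to P$ be a complete transversal function. Suppose: (1) if $\mathbf t\in\mathcal T_x^a$, then $|\operatorname{supp}\mathbf t|=\rho(x)$; (2) for every nonzero $x\in P$ there is an index $i$ with $|A_i\cap A_x|=1$. Then: (a) $P\cong\left(\prod_{i=1}^nRT_{\hat U(A_i)}\right)/\ker f$; (b) for each $x\in P$, $\mu(x)=(-1)^{\rho(x)}|\mathcal T_x^a|$; (c) $\chi(P,t)=t^{m-n}\prod_{i=1}^n(t-|A_i|)$.
   Context: All posets are finite with minimum $\hat0$; $\mu(x)$ is the Möbius function ($\sum_{y\le x}\mu(y)=\delta_{\hat0,x}$), and $\chi(P,t)=\sum_{x\in P}\mu(x)t^{m-\rho(x)}$ is the characteristic polynomial with respect to $\rho$ and $m$. $A_x$ is the set of atoms of $P$ below $x$. For $S\subseteq P$ containing $\hat0$, $RT_S$ is the poset of saturated chains of $P$ starting at $\hat0$ using only elements of $S$, ordered by containment; elements are identified with the top element of the chain. $\hat U(A)$ is the upper order ideal generated by a set of atoms $A$, together with $\hat0$. The product of rooted trees is ordered componentwise, elements $\mathbf t=(t_1,\dots,t_n)$. A complete transversal function is an order-preserving $f:\prod_iRT_{\hat U(A_i)}\to P$ such that if each $t_i$ is $\hat0$ or (has top element) $x$, then $f(\mathbf t)=x$.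 $\ker f$ is the equivalence $\mathbf s\sim\mathbf t\iff f(\mathbf s)=f(\mathbf t)$; $\mathcal T_x=f^{-1}(x)$; $\mathbf t$ is atomic if each $t_i$ is $\hat0$ or an atom of $RT_{\hat U(A_i)}$; $\mathcal T_x^a$ is the set of atomic elements of $\mathcal T_x$; $\operatorname{supp}\mathbf t=\{i:t_i\neq\hat0\}$. For an equivalence relation $\sim$ on a poset $Q$, $Q/\sim$ is the set of classes with $X\le Y$ iff $x\le y$ for some $x\in X,y\in Y$. *)

theory Defs
  imports
    "HOL-Library.FuncSet"
    "HOL-Library.Disjoint_Sets"
    "HOL-Computational_Algebra.Polynomial"
begin

text \<open>
  The poset \<open>P\<close> is a type of class \<open>finite\<close> and \<open>order_bot\<close>.  Posets built from it (rooted trees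
  and their products) are subsets of ordered types with the induced order.
\<close>

definition covers_in :: "'a::order set \<Rightarrow> 'a \<Rightarrow> 'a \<Rightarrow> bool" where
  "covers_in S x y \<longleftrightarrow> x \<in> S \<and> y \<in> S \<and> x < y \<and> \<not> (\<exists>z\<in>S. x < z \<and> z < y)"

text \<open>Atoms of the poset \<open>S\<close>, where \<open>z\<close> is the minimum of \<open>S\<close>.\<close>

definition atoms_in :: "'a::order set \<Rightarrow> 'a \<Rightarrow> 'a set" where
  "atoms_in S z = {a. covers_in S z a}"

abbreviation atoms :: "'a::order_bot set" where
  "atoms \<equiv> atoms_in UNIV bot"

definition atoms_below :: "'a::order_bot \<Rightarrow> 'a set" where
  "atoms_below x = {a \<in> atoms. a \<le> x}"

function mobius :: "'a::{finite,order_bot} \<Rightarrow> int" where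
  "mobius x = (if x = bot then 1 else - (\<Sum>y | y < x. mobius y))"
  by auto
termination
proof (relation "measure (\<lambda>x. card {y. y < x})")
  show "wf (measure (\<lambda>x::'a. card {y. y < x}))" by simp
next
  fix x y :: 'a
  assume "y \<in> {y. y < x}"
  then have "{z. z < y} \<subset> {z. z < x}" by auto
  then show "(y, x) \<in> measure (\<lambda>x. card {y. y < x})"
    by (simp add: psubset_card_mono)
qed

declare mobius.simps [simp del]

lemma mobius_sum:
  fixes x :: "'a::{finite,order_bot}"
  shows "(\<Sum>y | y \<le> x. mobius y) = (if x = bot then 1 else 0)"
proof -
  have "{y. y \<le> x} = insert x {y. y < x}" by auto
  then have "(\<Sum>y | y \<le> x. mobius y) = mobius x + (\<Sum>y | y < x. mobius y)" by simp
  also have "\<dots> = (if x = bot then 1 else 0)"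
    by (subst mobius.simps) simp
  finally show ?thesis .
qed

definition characteristic_poly :: "('a::{finite,order_bot} \<Rightarrow> nat) \<Rightarrow> nat \<Rightarrow> int poly" where
  "characteristic_poly \<rho> m = (\<Sum>x\<in>UNIV. monom (mobius x) (m - \<rho> x))"

definition saturated_chain :: "'a::order set \<Rightarrow> bool" where
  "saturated_chain C \<longleftrightarrow> Complete_Partial_Order.chain (\<le>) C \<and>
     (\<forall>x\<in>C. \<forall>y\<in>C. covers_in C x y \<longrightarrow> covers_in UNIV x y)"

text \<open>
  Chains are represented by their sets of elements, so that containment is \<open>\<subseteq>\<close>; the minimum
  of the rooted tree is the chain \<open>{bot}\<close>.
\<close>

definition rooted_tree :: "'a::order_bot set \<Rightarrow> 'a set set" where
  "rooted_tree S = {C. saturated_chain C \<and> bot \<in> C \<and> C \<subseteq> S}"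

definition top_elem :: "'a::order set \<Rightarrow> 'a" where
  "top_elem C = (GREATEST x. x \<in> C)"

definition upper_hat :: "'a::order_bot set \<Rightarrow> 'a set" where
  "upper_hat A = insert bot {x. \<exists>a\<in>A. a \<le> x}"

definition ordered_partition :: "'a set \<Rightarrow> nat \<Rightarrow> (nat \<Rightarrow> 'a set) \<Rightarrow> bool" where
  "ordered_partition S n A \<longleftrightarrow> inj_on A {1..n} \<and> partition_on S (A ` {1..n})"

text \<open>
  Elements are extensional functions, so the library order \<open>\<le>\<close> on functions into sets
  restricts to the componentwise order on \<open>{1..n}\<close>.
\<close>

definition tree_prod :: "nat \<Rightarrow> (nat \<Rightarrow> 'a::order_bot set) \<Rightarrow> (nat \<Rightarrow> 'a set) set" where
  "tree_prod n A = (\<Pi>\<^sub>E i\<in>{1..n}. rooted_tree (upper_hat (A i)))"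

text \<open>
  For \<open>x \<noteq> bot\<close> some component must actually have top element \<open>x\<close>; otherwise the minimum of the
  product would be sent to every \<open>x\<close>.
\<close>

definition complete_transversal ::
    "nat \<Rightarrow> (nat \<Rightarrow> 'a::order_bot set) \<Rightarrow> ((nat \<Rightarrow> 'a set) \<Rightarrow> 'a) \<Rightarrow> bool" where
  "complete_transversal n A f \<longleftrightarrow>
     mono_on (tree_prod n A) f \<and>
     (\<forall>t\<in>tree_prod n A. \<forall>x.
        (\<forall>i\<in>{1..n}. t i = {bot} \<or> top_elem (t i) = x) \<and>
        (x = bot \<or> (\<exists>i\<in>{1..n}. top_elem (t i) = x)) \<longrightarrow> f t = x)"

definition ker_on :: "'q set \<Rightarrow> ('q \<Rightarrow> 'a) \<Rightarrow> ('q \<times> 'q) set" where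
  "ker_on Q f = {(s, t). s \<in> Q \<and> t \<in> Q \<and> f s = f t}"

definition quotient_le :: "'q::order set \<Rightarrow> 'q set \<Rightarrow> bool" where
  "quotient_le X Y \<longleftrightarrow> (\<exists>x\<in>X. \<exists>y\<in>Y. x \<le> y)"

definition order_isomorphic ::
    "'a set \<Rightarrow> ('a \<Rightarrow> 'a \<Rightarrow> bool) \<Rightarrow> 'b set \<Rightarrow> ('b \<Rightarrow> 'b \<Rightarrow> bool) \<Rightarrow> bool" where
  "order_isomorphic S leS T leT \<longleftrightarrow>
     (\<exists>\<phi>. bij_betw \<phi> S T \<and> (\<forall>x\<in>S. \<forall>y\<in>S. leS x y \<longleftrightarrow> leT (\<phi> x) (\<phi> y)))"

definition supp :: "nat \<Rightarrow> (nat \<Rightarrow> 'a::order_bot set) \<Rightarrow> nat set" where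
  "supp n t = {i\<in>{1..n}. t i \<noteq> {bot}}"

definition transversals ::
    "nat \<Rightarrow> (nat \<Rightarrow> 'a::order_bot set) \<Rightarrow> ((nat \<Rightarrow> 'a set) \<Rightarrow> 'a) \<Rightarrow> 'a \<Rightarrow> (nat \<Rightarrow> 'a set) set" where
  "transversals n A f x = {t \<in> tree_prod n A. f t = x}"

definition atomic :: "nat \<Rightarrow> (nat \<Rightarrow> 'a::order_bot set) \<Rightarrow> (nat \<Rightarrow> 'a set) \<Rightarrow> bool" where
  "atomic n A t \<longleftrightarrow>
     (\<forall>i\<in>{1..n}. t i = {bot} \<or> t i \<in> atoms_in (rooted_tree (upper_hat (A i))) {bot})"

definition atomic_transversals ::
    "nat \<Rightarrow> (nat \<Rightarrow> 'a::order_bot set) \<Rightarrow> ((nat \<Rightarrow> 'a set) \<Rightarrow> 'a) \<Rightarrow> 'a \<Rightarrow> (nat \<Rightarrow> 'a set) set" where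
  "atomic_transversals n A f x = {t \<in> transversals n A f x. atomic n A t}"

end

theory Submission
  imports Defs
begin

text \<open>
  An atomic \<open>t\<close> satisfies \<open>f t \<le> x\<close> iff all its atoms lie below \<open>x\<close>: an atom \<open>a\<close> of \<open>t\<close> is the
  value of \<open>f\<close> at the element below \<open>t\<close> supported on that component, and conversely the nonzero
  components of \<open>t\<close> can all be prolonged to saturated chains ending in \<open>x\<close>.  Hence the atomic
  elements with \<open>f t \<le> x\<close> form a product, and the signed count of them is the product of the
  factors \<open>1 - |A\<^sub>i \<inter> A\<^sub>x|\<close>, which vanishes for \<open>x \<noteq> bot\<close> by (2).  By (1) the sign is
  \<open>(-1)^\<rho>(f t)\<close>, so uniqueness of the Moebius function gives (b), and expanding
  \<open>\<Prod>i. (X - |A\<^sub>i|)\<close> over all atomic elements gives (c).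
\<close>

text \<open>The sum over the ideal of \<open>x\<close> fixes the value at \<open>x\<close> once the
  values strictly below are known. Part (b) thus reduces to evaluating these sums for the
  candidate.\<close>

lemma mobius_unique:
  fixes g :: "'a::{finite,order_bot} \<Rightarrow> int"
  assumes g: "\<And>x. (\<Sum>y | y \<le> x. g y) = (if x = bot then 1 else 0)"
  shows "mobius x = g x"
proof (induction x rule: mobius.induct)
  case (1 x)
  have split: "(\<Sum>y | y \<le> x. h y) = h x + (\<Sum>y | y < x. h y)" for h :: "'a \<Rightarrow> int"
  proof -
    have "{y. y \<le> x} = insert x {y. y < x}" by auto
    then show ?thesis by simp
  qed
  have "(\<Sum>y | y < x. mobius y) = (\<Sum>y | y < x. g y)"
  proof (rule sum.cong)
    fix y assume y: "y \<in> {y. y < x}"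
    \<comment> \<open>The recursive call sits in the else branch, so \<open>mobius.induct\<close>
      grants its hypothesis only for nonzero \<open>x\<close>.\<close>
    then have "x \<noteq> bot" by auto
    with y show "mobius y = g y" using 1 by blast
  qed simp
  with split[of mobius] split[of g] mobius_sum[of x] g[of x] show ?case by simp
qed

section \<open>Top elements, atoms and saturated chains\<close>

lemma top_elem_eqI:
  assumes "x \<in> C" "\<And>c. c \<in> C \<Longrightarrow> c \<le> x"
  shows "top_elem C = x"
  unfolding top_elem_def using assms by (intro Greatest_equality) auto

text \<open>\<open>GREATEST\<close> is informative only where a greatest element exists. A finite
  nonempty chain has a maximal element, and comparability makes it the greatest.\<close>

lemma top_elem_greatest:
  fixes C :: "'a::{finite,order_bot} set"
  assumes "C \<in> rooted_tree S"
  shows "top_elem C \<in> C" "c \<in> C \<Longrightarrow> c \<le> top_elem C"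
proof -
  have chain: "Complete_Partial_Order.chain (\<le>) C" and "C \<noteq> {}"
    using assms by (auto simp: rooted_tree_def saturated_chain_def)
  then obtain x where x: "x \<in> C" "\<And>c. c \<in> C \<Longrightarrow> x \<le> c \<Longrightarrow> x = c"
    using finite_has_maximal[of C] by auto
  then have "c \<le> x" if "c \<in> C" for c using chain that by (metis chainD order_refl)
  then have "top_elem C = x" "\<And>c. c \<in> C \<Longrightarrow> c \<le> x" using x(1) top_elem_eqI by blast+
  then show "top_elem C \<in> C" "c \<in> C \<Longrightarrow> c \<le> top_elem C" using x(1) by auto
qed

lemma atom_eqI:
  assumes "a \<in> atoms" "b \<le> a" "b \<noteq> bot"
  shows "b = a"
  using assms bot.not_eq_extremum[of b] unfolding atoms_in_def covers_in_def by auto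

lemma atom_not_bot: "a \<in> atoms \<Longrightarrow> a \<noteq> bot"
  by (auto simp: atoms_in_def covers_in_def)

lemma exists_atom_below:
  fixes x :: "'a::{finite,order_bot}"
  assumes "x \<noteq> bot"
  shows "\<exists>a\<in>atoms. a \<le> x"
proof -
  have "finite {z. z \<noteq> bot \<and> z \<le> x}" "{z. z \<noteq> bot \<and> z \<le> x} \<noteq> {}"
    using assms by auto
  then obtain a where a: "a \<noteq> bot" "a \<le> x"
    and min: "\<And>z. z \<noteq> bot \<Longrightarrow> z \<le> x \<Longrightarrow> z \<le> a \<Longrightarrow> a = z"
    using finite_has_minimal[of "{z. z \<noteq> bot \<and> z \<le> x}"] by auto
  have "a \<in> atoms"
    unfolding atoms_in_def covers_in_def
    using a min by (auto simp: bot.not_eq_extremum) (metis a(2) bot.not_eq_extremum less_imp_le less_irrefl order_trans)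
  with a show ?thesis by blast
qed

lemma bot_in_rooted_tree: "{bot} \<in> rooted_tree (upper_hat A)"
  by (auto simp: rooted_tree_def saturated_chain_def upper_hat_def covers_in_def
      Complete_Partial_Order.chain_def)

lemma top_elem_atom: "top_elem {bot :: 'a::order_bot, a} = a"
  by (rule top_elem_eqI) auto

lemma atom_in_rooted_tree:
  assumes "a \<in> A" "a \<in> atoms"
  shows "{bot, a} \<in> rooted_tree (upper_hat A)"
  using assms
  by (auto simp: rooted_tree_def saturated_chain_def upper_hat_def
      Complete_Partial_Order.chain_def atoms_in_def) (auto simp: covers_in_def)

text \<open>The chain grows by one cover at a time: a minimal \<open>z\<close> with
  \<open>x < z \<le> y\<close> covers \<open>x\<close>, and the interval left up to \<open>y\<close>
  shrinks. Since \<open>x\<close> is nonzero, it lies above a member of \<open>A\<close>, hence so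
  does every new element and the chain stays in \<open>upper_hat A\<close>.\<close>

lemma saturated_chain_extend:
  fixes x y :: "'a::{finite,order_bot}"
  assumes "C \<in> rooted_tree (upper_hat A)" "x \<in> C" "\<And>c. c \<in> C \<Longrightarrow> c \<le> x" "x \<noteq> bot" "x \<le> y"
  shows "\<exists>D\<in>rooted_tree (upper_hat A). C \<subseteq> D \<and> top_elem D = y"
  using assms
proof (induction "card {z. x < z \<and> z \<le> y}" arbitrary: x C rule: less_induct)
  case less
  show ?case
  proof (cases "x = y")
    case True
    then show ?thesis using less.prems top_elem_eqI[of x C] by blast
  next
    case False
    then have "y \<in> {z. x < z \<and> z \<le> y}" using less.prems(5) by simp
    then have "{z. x < z \<and> z \<le> y} \<noteq> {}" by blast
    then obtain z where z: "x < z" "z \<le> y"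
      and min: "\<And>w. x < w \<Longrightarrow> w \<le> y \<Longrightarrow> w \<le> z \<Longrightarrow> z = w"
      using finite_has_minimal[of "{z. x < z \<and> z \<le> y}"] by auto
    have xz: "covers_in UNIV x z"
      unfolding covers_in_def using z min by (metis UNIV_I less_le_not_le order_trans)
    have below: "c \<le> x" if "c \<in> C" for c using less.prems(3) that .
    have below': "c < z" if "c \<in> C" for c using below[OF that] z(1) by simp
    have tree: "insert z C \<in> rooted_tree (upper_hat A)"
    proof -
      have "Complete_Partial_Order.chain (\<le>) (insert z C)"
        using less.prems(1) below'
        by (auto simp: rooted_tree_def saturated_chain_def Complete_Partial_Order.chain_def
            less_imp_le)
      \<comment> \<open>A cover ending in \<open>z\<close> must start at \<open>x\<close>, since
        \<open>x\<close> would otherwise lie strictly between. Every other cover is already one of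
        \<open>C\<close>.\<close>
      moreover have "covers_in UNIV p q" if pq: "covers_in (insert z C) p q" for p q
      proof (cases "q = z")
        case True
        then have "p \<in> C" using pq by (auto simp: covers_in_def)
        moreover have "\<not> p < x" using pq True z(1) less.prems(2) by (auto simp: covers_in_def)
        ultimately show ?thesis using xz True below[of p] by (auto simp: le_less)
      next
        case False
        then have "q \<in> C" using pq by (auto simp: covers_in_def)
        then have "p \<noteq> z" using below' pq by (auto simp: covers_in_def dest: less_asym)
        then have "covers_in C p q" using pq False by (auto simp: covers_in_def)
        moreover from this have "p \<in> C" by (simp add: covers_in_def)
        ultimately show ?thesis
          using less.prems(1) \<open>q \<in> C\<close> unfolding rooted_tree_def saturated_chain_def by blast
      qed
      moreover have "z \<in> upper_hat A"
      proof -
        have "x \<in> upper_hat A" using less.prems(1,2) by (auto simp: rooted_tree_def)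
        then obtain a where "a \<in> A" "a \<le> x" using less.prems(4) by (auto simp: upper_hat_def)
        moreover from this have "a \<le> z" using z(1) by simp
        ultimately show ?thesis by (auto simp: upper_hat_def)
      qed
      moreover have "bot \<in> C" "C \<subseteq> upper_hat A" using less.prems(1) by (auto simp: rooted_tree_def)
      ultimately show ?thesis by (simp add: rooted_tree_def saturated_chain_def)
    qed
    have "{w. z < w \<and> w \<le> y} \<subset> {w. x < w \<and> w \<le> y}" using z by auto
    then have "card {w. z < w \<and> w \<le> y} < card {w. x < w \<and> w \<le> y}"
      by (simp add: psubset_card_mono)
    then have "\<exists>D\<in>rooted_tree (upper_hat A). insert z C \<subseteq> D \<and> top_elem D = y"
    proof (rule less.hyps)
      show "c \<le> z" if "c \<in> insert z C" for c using that below' by (auto simp: less_imp_le)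
      show "z \<noteq> bot" using z(1) by auto
    qed (use tree z in auto)
    then show ?thesis by auto
  qed
qed

lemma chain_from_atom:
  fixes y :: "'a::{finite,order_bot}"
  assumes "a \<in> A" "a \<in> atoms" "a \<le> y"
  shows "\<exists>D\<in>rooted_tree (upper_hat A). {bot, a} \<subseteq> D \<and> top_elem D = y"
  using assms atom_in_rooted_tree[OF assms(1,2)] atom_not_bot[OF assms(2)]
  by (intro saturated_chain_extend[where x = a]) auto

text \<open>The least nonzero element \<open>b\<close> of an atom \<open>C\<close> of the tree
  covers \<open>bot\<close> in \<open>C\<close>, so saturation makes it an atom of the poset. The
  chain \<open>{bot, b}\<close> is then itself in the tree, and nothing nonzero lies strictly below
  \<open>C\<close>, so the two coincide.\<close>

lemma atoms_rooted_tree: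
  fixes A :: "'a::{finite,order_bot} set"
  assumes "A \<subseteq> atoms"
  shows "atoms_in (rooted_tree (upper_hat A)) {bot} = (\<lambda>a. {bot, a}) ` A"
proof (intro equalityI subsetI)
  fix C assume "C \<in> atoms_in (rooted_tree (upper_hat A)) {bot}"
  then have C: "C \<in> rooted_tree (upper_hat A)" "{bot} \<subset> C"
    and between: "\<And>D. D \<in> rooted_tree (upper_hat A) \<Longrightarrow> {bot} \<subset> D \<Longrightarrow> \<not> D \<subset> C"
    by (auto simp: atoms_in_def covers_in_def)
  have "C - {bot} \<noteq> {}" using C by auto
  then obtain b where b: "b \<in> C" "b \<noteq> bot"
    and min: "\<And>c. c \<in> C \<Longrightarrow> c \<noteq> bot \<Longrightarrow> c \<le> b \<Longrightarrow> b = c"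
    using finite_has_minimal[of "C - {bot}"] by auto
  have "\<not> c < b" if "c \<in> C" "bot < c" for c
    using min[OF that(1)] that(2) by (auto simp: less_le)
  then have "covers_in C bot b"
    using b C(2) by (auto simp: covers_in_def bot.not_eq_extremum)
  then have atom: "b \<in> atoms"
    using C(1) b by (auto simp: rooted_tree_def saturated_chain_def atoms_in_def)
  have "b \<in> upper_hat A" using C(1) b by (auto simp: rooted_tree_def)
  then obtain a where "a \<in> A" "a \<le> b" using b by (auto simp: upper_hat_def)
  then have "b \<in> A" using atom_eqI[OF atom] assms atom_not_bot by blast
  then have "{bot, b} \<in> rooted_tree (upper_hat A)" using atom by (rule atom_in_rooted_tree)
  then have "\<not> {bot, b} \<subset> C" using between b by blast
  then have "C = {bot, b}" using b C(2) by blast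
  then show "C \<in> (\<lambda>a. {bot, a}) ` A" using \<open>b \<in> A\<close> by blast
next
  fix C assume "C \<in> (\<lambda>a. {bot, a}) ` A"
  then obtain a where a: "a \<in> A" "C = {bot, a}" by blast
  then have "a \<noteq> bot" using assms atom_not_bot by blast
  then show "C \<in> atoms_in (rooted_tree (upper_hat A)) {bot}"
    using a assms atom_in_rooted_tree[of a A] bot_in_rooted_tree[of A]
    by (auto simp: atoms_in_def covers_in_def psubset_eq)
qed

section \<open>Signed sums over products of atomic trees\<close>

definition atomic_trees :: "'a::order_bot set \<Rightarrow> 'a set set" where
  "atomic_trees A = insert {bot} ((\<lambda>a. {bot, a}) ` A)"

text \<open>Expanding the product chooses one tree per component, where \<open>{bot}\<close> has
  weight \<open>X\<close> and each atom has weight -1. With \<open>X = 1\<close> and blocks cut down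
  to the atoms below an element this yields Moebius sums; with \<open>X\<close> the polynomial
  variable and full blocks it yields the characteristic polynomial.\<close>

lemma sum_signed_supp:
  fixes X :: "'r::comm_ring_1" and C :: "nat \<Rightarrow> 'a::{finite,order_bot} set"
  assumes "\<And>i. i \<in> {1..n} \<Longrightarrow> bot \<notin> C i"
  shows "(\<Sum>t\<in>(\<Pi>\<^sub>E i\<in>{1..n}. atomic_trees (C i)). (-1) ^ card (supp n t) * X ^ (n - card (supp n t)))
    = (\<Prod>i=1..n. X - of_nat (card (C i)))"
proof -
  let ?w = "\<lambda>t. if t = {bot} then X else - 1"
  have fac: "(\<Sum>t\<in>atomic_trees (C i). ?w t) = X - of_nat (card (C i))" if "i \<in> {1..n}" for i
  proof -
    have "inj_on (\<lambda>a. {bot, a}) (C i)" using assms[OF that] by (auto simp: inj_on_def doubleton_eq_iff)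
    moreover have "(\<Sum>t\<in>(\<lambda>a. {bot, a}) ` C i. ?w t) = (\<Sum>t\<in>(\<lambda>a. {bot, a}) ` C i. - 1)"
      using assms[OF that] by (intro sum.cong) auto
    \<comment> \<open>The bottom tree stays apart from the doubletons because \<open>bot\<close> is
      not in \<open>C i\<close>; its weight \<open>X\<close> is therefore a separate
      summand.\<close>
    moreover have "{bot} \<notin> (\<lambda>a. {bot, a}) ` C i" using assms[OF that] by auto
    ultimately show ?thesis by (simp add: atomic_trees_def card_image)
  qed
  have weight: "(\<Prod>i=1..n. ?w (t i)) = (-1) ^ card (supp n t) * X ^ (n - card (supp n t))"
    for t :: "nat \<Rightarrow> 'a set"
  proof -
    have "{1..n} = supp n t \<union> {i\<in>{1..n}. t i = {bot}}" by (auto simp: supp_def)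
    then have "(\<Prod>i=1..n. ?w (t i)) = (\<Prod>i\<in>supp n t. ?w (t i)) * (\<Prod>i\<in>{i\<in>{1..n}. t i = {bot}}. ?w (t i))"
      by (metis (no_types, lifting) prod.union_disjoint Int_emptyI finite_Un finite_atLeastAtMost mem_Collect_eq supp_def)
    also have "(\<Prod>i\<in>supp n t. ?w (t i)) = (-1) ^ card (supp n t)"
      by (subst prod.cong[OF refl, of _ _ "\<lambda>_. - 1"]) (auto simp: supp_def)
    also have "(\<Prod>i\<in>{i\<in>{1..n}. t i = {bot}}. ?w (t i)) = X ^ card {i\<in>{1..n}. t i = {bot}}"
      by (subst prod.cong[OF refl, of _ _ "\<lambda>_. X"]) auto
    also have "{i\<in>{1..n}. t i = {bot}} = {1..n} - supp n t" by (auto simp: supp_def)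
    also have "card \<dots> = n - card (supp n t)" by (subst card_Diff_subset) (auto simp: supp_def)
    finally show ?thesis .
  qed
  have "(\<Prod>i=1..n. X - of_nat (card (C i))) = (\<Prod>i=1..n. \<Sum>t\<in>atomic_trees (C i). ?w t)"
    by (rule prod.cong) (simp_all add: fac)
  also have "\<dots> = (\<Sum>t\<in>(\<Pi>\<^sub>E i\<in>{1..n}. atomic_trees (C i)). \<Prod>i=1..n. ?w (t i))"
    by (rule prod_sum_PiE) (auto simp: atomic_trees_def)
  finally show ?thesis by (simp only: weight)
qed

lemma card_supp_le: "card (supp n t) \<le> n"
proof -
  have "supp n t \<subseteq> {1..n}" by (auto simp: supp_def)
  then have "card (supp n t) \<le> card {1..n}" by (intro card_mono) auto
  then show ?thesis by simp
qed

section \<open>The transversal function and its quotient\<close>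

locale transversal =
  fixes n :: nat and A :: "nat \<Rightarrow> 'a::{finite,order_bot} set" and f :: "(nat \<Rightarrow> 'a set) \<Rightarrow> 'a"
  assumes partition: "ordered_partition atoms n A" and f: "complete_transversal n A f"
begin

lemma block_atoms: "i \<in> {1..n} \<Longrightarrow> A i \<subseteq> atoms"
  using partition unfolding ordered_partition_def partition_on_def by blast

lemma bot_notin_block: "i \<in> {1..n} \<Longrightarrow> bot \<notin> A i"
  using block_atoms atom_not_bot by blast

lemma block_nonempty: "i \<in> {1..n} \<Longrightarrow> A i \<noteq> {}"
  using partition unfolding ordered_partition_def partition_on_def by (metis imageI)

lemma atom_in_block: "a \<in> atoms \<Longrightarrow> \<exists>i\<in>{1..n}. a \<in> A i"
  using partition unfolding ordered_partition_def partition_on_def by blast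

lemma f_mono: "s \<in> tree_prod n A \<Longrightarrow> t \<in> tree_prod n A \<Longrightarrow> s \<le> t \<Longrightarrow> f s \<le> f t"
  using f unfolding complete_transversal_def by (blast dest: mono_onD)

lemma f_eq:
  assumes "t \<in> tree_prod n A" "\<And>i. i \<in> {1..n} \<Longrightarrow> t i = {bot} \<or> top_elem (t i) = x"
    and "x = bot \<or> (\<exists>i\<in>{1..n}. top_elem (t i) = x)"
  shows "f t = x"
  using f assms unfolding complete_transversal_def by blast

text \<open>Embeds one tree into the product, where \<open>f\<close> merely reads off the top of a
  chain. Restriction gives the value \<open>undefined\<close> outside \<open>{1..n}\<close>, as for
  all members of \<open>tree_prod n A\<close>, so \<open>\<le>\<close> really compares components
  only.\<close>

definition single :: "nat \<Rightarrow> 'a set \<Rightarrow> nat \<Rightarrow> 'a set" where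
  "single i C = (\<lambda>j\<in>{1..n}. if j = i then C else {bot})"

lemma single_in: "i \<in> {1..n} \<Longrightarrow> C \<in> rooted_tree (upper_hat (A i)) \<Longrightarrow> single i C \<in> tree_prod n A"
  by (auto simp: single_def tree_prod_def bot_in_rooted_tree)

lemma f_single:
  assumes "i \<in> {1..n}" "C \<in> rooted_tree (upper_hat (A i))"
  shows "f (single i C) = top_elem C"
  using assms by (intro f_eq single_in) (auto simp: single_def)

lemma single_mono: "C \<subseteq> D \<Longrightarrow> single i C \<le> single i D"
  by (auto simp: single_def le_fun_def)

lemma single_le: "t \<in> tree_prod n A \<Longrightarrow> single i (t i) \<le> t"
  by (auto simp: single_def le_fun_def tree_prod_def rooted_tree_def PiE_def extensional_def)

lemma bottom_in: "(\<lambda>i\<in>{1..n}. {bot}) \<in> tree_prod n A"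
  by (auto simp: tree_prod_def bot_in_rooted_tree)

lemma bottom_le: "t \<in> tree_prod n A \<Longrightarrow> (\<lambda>i\<in>{1..n}. {bot}) \<le> t"
  by (auto simp: le_fun_def tree_prod_def rooted_tree_def PiE_def extensional_def)

lemma f_bottom: "f (\<lambda>i\<in>{1..n}. {bot}) = bot"
  by (rule f_eq[OF bottom_in]) auto

text \<open>A nonzero \<open>x\<close> lies above an atom of some block; a saturated chain through
  that atom up to \<open>x\<close>, alone in its component, is sent to \<open>x\<close>.\<close>

lemma f_surj_ex: "\<exists>t\<in>tree_prod n A. f t = x"
proof (cases "x = bot")
  case True
  then show ?thesis using bottom_in f_bottom by blast
next
  case False
  then obtain a where "a \<in> atoms" "a \<le> x" using exists_atom_below by blast
  moreover from this obtain i where "i \<in> {1..n}" "a \<in> A i" using atom_in_block by blast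
  ultimately show ?thesis using chain_from_atom[of a "A i" x] single_in f_single by metis
qed

text \<open>The quotient order asks for comparable representatives. They are found inside a single
  tree, by prolonging a chain that ends in \<open>x\<close> to one that ends in
  \<open>y\<close>.\<close>

lemma f_le_lift:
  assumes "x \<le> y"
  shows "\<exists>s\<in>tree_prod n A. \<exists>t\<in>tree_prod n A. s \<le> t \<and> f s = x \<and> f t = y"
proof (cases "x = bot")
  case True
  then show ?thesis using bottom_in f_bottom f_surj_ex[of y] bottom_le by blast
next
  case False
  then obtain a where a: "a \<in> atoms" "a \<le> x" using exists_atom_below by blast
  then obtain i where i: "i \<in> {1..n}" "a \<in> A i" using atom_in_block by blast
  obtain C where C: "C \<in> rooted_tree (upper_hat (A i))" "{bot, a} \<subseteq> C" "top_elem C = x"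
    using chain_from_atom[of a "A i" x] a i by blast
  have "x \<in> C" "\<And>c. c \<in> C \<Longrightarrow> c \<le> x" using top_elem_greatest[OF C(1)] C(3) by auto
  with C(1) False assms obtain D where D: "D \<in> rooted_tree (upper_hat (A i))" "C \<subseteq> D" "top_elem D = y"
    using saturated_chain_extend by blast
  show ?thesis
    using single_in[OF i(1)] f_single[OF i(1)] single_mono[OF D(2)] C D by metis
qed

text \<open>The isomorphism sends \<open>x\<close> to its fibre under \<open>f\<close>. It preserves
  order by \<open>f_le_lift\<close> and reflects it by monotonicity of \<open>f\<close>.\<close>

lemma quotient_isomorphic:
  "order_isomorphic (UNIV :: 'a set) (\<le>) (tree_prod n A // ker_on (tree_prod n A) f) quotient_le"
proof -
  let ?K = "ker_on (tree_prod n A) f"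
  let ?T = "transversals n A f"
  have cls: "?K `` {t} = ?T (f t)" if "t \<in> tree_prod n A" for t
    using that by (auto simp: ker_on_def transversals_def)
  have ne: "?T x \<noteq> {}" for x using f_surj_ex[of x] by (auto simp: transversals_def)
  have "?T x = ?T y \<Longrightarrow> x = y" for x y using ne[of x] by (auto simp: transversals_def)
  then have "inj ?T" by (rule injI)
  moreover have "range ?T = tree_prod n A // ?K"
  proof (intro equalityI subsetI)
    fix X assume "X \<in> range ?T"
    then obtain x where "X = ?T x" by blast
    moreover obtain t where "t \<in> tree_prod n A" "f t = x" using f_surj_ex by blast
    ultimately show "X \<in> tree_prod n A // ?K" using cls by (metis quotientI)
  next
    fix X assume "X \<in> tree_prod n A // ?K"
    then show "X \<in> range ?T" using cls by (auto elim!: quotientE)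
  qed
  moreover have "x \<le> y \<longleftrightarrow> quotient_le (?T x) (?T y)" for x y
  proof
    assume "x \<le> y"
    then show "quotient_le (?T x) (?T y)"
      using f_le_lift unfolding quotient_le_def transversals_def by blast
  next
    assume "quotient_le (?T x) (?T y)"
    then show "x \<le> y" using f_mono by (auto simp: quotient_le_def transversals_def)
  qed
  ultimately show ?thesis unfolding order_isomorphic_def bij_betw_def by blast
qed

section \<open>Atomic elements and their values\<close>

lemma atomic_trees_subset: "i \<in> {1..n} \<Longrightarrow> atomic_trees (A i) \<subseteq> rooted_tree (upper_hat (A i))"
  using block_atoms atom_in_rooted_tree bot_in_rooted_tree by (fastforce simp: atomic_trees_def)

lemma atomic_subset: "(\<Pi>\<^sub>E i\<in>{1..n}. atomic_trees (A i)) \<subseteq> tree_prod n A"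
  unfolding tree_prod_def using atomic_trees_subset by (rule PiE_mono)

text \<open>Being atomic is a componentwise condition, so the atomic elements form a full product;
  in this form they can be summed by distributivity.\<close>

lemma atomic_transversals_eq:
  "atomic_transversals n A f x = {t \<in> (\<Pi>\<^sub>E i\<in>{1..n}. atomic_trees (A i)). f t = x}"
proof -
  have "t i = {bot} \<or> t i \<in> atoms_in (rooted_tree (upper_hat (A i))) {bot} \<longleftrightarrow>
      t i \<in> atomic_trees (A i)" if "i \<in> {1..n}" for t i
    using atoms_rooted_tree[OF block_atoms[OF that]] by (simp add: atomic_trees_def)
  then have atomic: "atomic n A t \<longleftrightarrow> (\<forall>i\<in>{1..n}. t i \<in> atomic_trees (A i))" for t
    unfolding atomic_def by simp
  have "{t \<in> tree_prod n A. atomic n A t} =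
      tree_prod n A \<inter> (\<Pi>\<^sub>E i\<in>{1..n}. atomic_trees (A i))"
    by (rule set_eqI) (simp only: mem_Collect_eq Int_iff tree_prod_def PiE_iff atomic, blast)
  also have "\<dots> = (\<Pi>\<^sub>E i\<in>{1..n}. atomic_trees (A i))"
    using atomic_subset by (rule Int_absorb1)
  finally have eq: "{t \<in> tree_prod n A. atomic n A t} = (\<Pi>\<^sub>E i\<in>{1..n}. atomic_trees (A i))" .
  have "atomic_transversals n A f x = {t \<in> {t \<in> tree_prod n A. atomic n A t}. f t = x}"
    by (auto simp: atomic_transversals_def transversals_def)
  then show ?thesis unfolding eq .
qed

lemma atomic_f_le_iff:
  assumes t: "t \<in> (\<Pi>\<^sub>E i\<in>{1..n}. atomic_trees (A i))"
  shows "f t \<le> x \<longleftrightarrow> t \<in> (\<Pi>\<^sub>E i\<in>{1..n}. atomic_trees (A i \<inter> atoms_below x))"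
proof -
  have tp: "t \<in> tree_prod n A"
    using t atomic_subset by (rule subsetD[rotated])
  show ?thesis
  proof
    assume le: "f t \<le> x"
    have "t i \<in> atomic_trees (A i \<inter> atoms_below x)" if i: "i \<in> {1..n}" for i
    proof (cases "t i = {bot}")
      case False
      then obtain a where a: "a \<in> A i" "t i = {bot, a}"
        using PiE_mem[OF t i] by (auto simp: atomic_trees_def)
      have ti: "t i \<in> rooted_tree (upper_hat (A i))"
        using tp i unfolding tree_prod_def by (rule PiE_mem)
      \<comment> \<open>The single component \<open>t i\<close> is below \<open>t\<close> and has
        value \<open>a\<close>, so monotonicity bounds \<open>a\<close> by
        \<open>f t\<close>.\<close>
      have "a = f (single i (t i))" using f_single[OF i ti] a by (simp add: top_elem_atom)
      also have "\<dots> \<le> f t" using f_mono[OF single_in[OF i ti] tp single_le[OF tp]] .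
      finally show ?thesis using le a block_atoms[OF i] by (auto simp: atomic_trees_def atoms_below_def)
    qed (simp add: atomic_trees_def)
    then show "t \<in> (\<Pi>\<^sub>E i\<in>{1..n}. atomic_trees (A i \<inter> atoms_below x))"
      using t by (simp add: PiE_iff)
  next
    assume u: "t \<in> (\<Pi>\<^sub>E i\<in>{1..n}. atomic_trees (A i \<inter> atoms_below x))"
    \<comment> \<open>Nonzero components are prolonged up to \<open>x\<close>, while zero components
      stay zero: the resulting element has exactly the shape on which \<open>f\<close> is
      prescribed.\<close>
    have "\<exists>D. D \<in> rooted_tree (upper_hat (A i)) \<and> t i \<subseteq> D \<and>
        (if t i = {bot} then D = {bot} else top_elem D = x)" if i: "i \<in> {1..n}" for i
    proof (cases "t i = {bot}")
      case False
      then obtain a where "a \<in> A i" "a \<in> atoms" "a \<le> x" "t i = {bot, a}"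
        using PiE_mem[OF u i] by (auto simp: atomic_trees_def atoms_below_def)
      then show ?thesis using chain_from_atom[of a "A i" x] False by auto
    qed (simp add: bot_in_rooted_tree)
    then obtain D where D: "\<And>i. i \<in> {1..n} \<Longrightarrow> D i \<in> rooted_tree (upper_hat (A i)) \<and> t i \<subseteq> D i \<and>
        (if t i = {bot} then D i = {bot} else top_elem (D i) = x)"
      by metis
    show "f t \<le> x"
    \<comment> \<open>If \<open>x\<close> is nonzero, the value \<open>x\<close> is prescribed only
      when some component really has top \<open>x\<close>. The zero element is therefore treated
      apart, through \<open>f_bottom\<close>.\<close>
    proof (cases "\<exists>i\<in>{1..n}. t i \<noteq> {bot}")
      case True
      let ?D = "\<lambda>i\<in>{1..n}. D i"
      have Dp: "?D \<in> tree_prod n A" using D by (auto simp: tree_prod_def)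
      have "t \<le> ?D" using D PiE_arb[OF t] by (auto simp: le_fun_def)
      then have "f t \<le> f ?D" using f_mono tp Dp by blast
      also have "f ?D = x"
      proof (rule f_eq[OF Dp])
        show "?D i = {bot} \<or> top_elem (?D i) = x" if "i \<in> {1..n}" for i
          using D[OF that] that by (simp split: if_splits)
        obtain i where "i \<in> {1..n}" "t i \<noteq> {bot}" using True by blast
        then have "i \<in> {1..n} \<and> top_elem (?D i) = x" using D[of i] by simp
        then show "x = bot \<or> (\<exists>i\<in>{1..n}. top_elem (?D i) = x)" by blast
      qed
      finally show ?thesis .
    next
      case False
      then have "t = (\<lambda>i\<in>{1..n}. {bot})" using PiE_arb[OF t] by (intro ext) (simp add: restrict_def)
      then show ?thesis using f_bottom by simp
    qed
  qed
qed

lemma finite_atomic_trees: "finite (\<Pi>\<^sub>E i\<in>{1..n}. atomic_trees (A i))"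
  by (intro finite_PiE) (auto simp: atomic_trees_def)

end

section \<open>Moebius function and characteristic polynomial\<close>

locale ranked_transversal = transversal +
  fixes \<rho> :: "'a::{finite,order_bot} \<Rightarrow> nat"
  assumes card_supp: "t \<in> atomic_transversals n A f x \<Longrightarrow> card (supp n t) = \<rho> x"
    and unique_atom: "x \<noteq> bot \<Longrightarrow> \<exists>i\<in>{1..n}. card (A i \<inter> atoms_below x) = 1"
begin

text \<open>Condition (1) read along \<open>f\<close>: signs and exponents given by
  \<open>\<rho>\<close> become functions of the support alone.\<close>

lemma rank_f: "t \<in> (\<Pi>\<^sub>E i\<in>{1..n}. atomic_trees (A i)) \<Longrightarrow> \<rho> (f t) = card (supp n t)"
  using card_supp[of t "f t"] by (simp add: atomic_transversals_eq)

text \<open>By (1) the sign is constant on the atomic elements over \<open>x\<close>, so the signed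
  sum has no cancellation.\<close>

lemma signed_count:
  "(-1) ^ \<rho> x * int (card (atomic_transversals n A f x)) =
    (\<Sum>t\<in>{t \<in> (\<Pi>\<^sub>E i\<in>{1..n}. atomic_trees (A i)). f t = x}. (-1) ^ card (supp n t))"
proof -
  have "(\<Sum>t\<in>atomic_transversals n A f x. (-1) ^ card (supp n t)) =
      (\<Sum>t\<in>atomic_transversals n A f x. (-1 :: int) ^ \<rho> x)"
    using card_supp by (intro sum.cong) auto
  then show ?thesis by (simp add: atomic_transversals_eq)
qed

lemma mobius_eq: "mobius x = (-1) ^ \<rho> x * int (card (atomic_transversals n A f x))"
proof (rule mobius_unique)
  fix x
  let ?At = "\<Pi>\<^sub>E i\<in>{1..n}. atomic_trees (A i)"
  let ?B = "\<Pi>\<^sub>E i\<in>{1..n}. atomic_trees (A i \<inter> atoms_below x)"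
  \<comment> \<open>One set in two forms: as a product its signed sum factors, and as a set cut out
    by \<open>f t \<le> x\<close> it splits into the fibres over all
    \<open>y \<le> x\<close>.\<close>
  have B: "?B = {t \<in> ?At. f t \<le> x}"
  proof -
    have "?B \<subseteq> ?At" by (intro PiE_mono) (auto simp: atomic_trees_def)
    then show ?thesis using atomic_f_le_iff by blast
  qed
  have "(\<Sum>y | y \<le> x. (-1) ^ \<rho> y * int (card (atomic_transversals n A f y))) =
      (\<Sum>y | y \<le> x. \<Sum>t\<in>{t \<in> ?B. f t = y}. (-1) ^ card (supp n t))"
  proof (rule sum.cong)
    fix y assume "y \<in> {y. y \<le> x}"
    then have "{t \<in> ?B. f t = y} = {t \<in> ?At. f t = y}" unfolding B by auto
    then show "(-1) ^ \<rho> y * int (card (atomic_transversals n A f y)) =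
        (\<Sum>t\<in>{t \<in> ?B. f t = y}. (-1) ^ card (supp n t))"
      by (simp only: signed_count)
  qed simp
  also have "\<dots> = (\<Sum>t\<in>?B. (-1) ^ card (supp n t))"
    unfolding B using finite_atomic_trees by (intro sum.group) auto
  also have "\<dots> = (\<Prod>i=1..n. 1 - int (card (A i \<inter> atoms_below x)))"
    using sum_signed_supp[of n "\<lambda>i. A i \<inter> atoms_below x" "1 :: int"] bot_notin_block by simp
  also have "\<dots> = (if x = bot then 1 else 0)"
  proof (cases "x = bot")
    case True
    then have "atoms_below x = {}" by (auto simp: atoms_below_def atoms_in_def covers_in_def bot_unique)
    with True show ?thesis by simp
  next
    case False
    \<comment> \<open>Condition (2) provides a factor \<open>1 - 1\<close>.\<close>
    then obtain i where "i \<in> {1..n}" "card (A i \<inter> atoms_below x) = 1" using unique_atom by blast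
    with False show ?thesis by (auto intro!: prod_zero bexI[of _ i])
  qed
  finally show "(\<Sum>y | y \<le> x. (-1) ^ \<rho> y * int (card (atomic_transversals n A f y))) =
    (if x = bot then 1 else 0)" .
qed

text \<open>One atom from each nonempty block gives an atomic element of full support. Its value has
  rank \<open>n\<close>, which forces \<open>n \<le> m\<close> and makes the exponent
  \<open>m - n\<close> a genuine difference.\<close>

lemma full_rank_exists: "\<exists>x. \<rho> x = n"
proof -
  have "\<forall>i\<in>{1..n}. \<exists>a. a \<in> A i" using block_nonempty by blast
  then obtain a where a: "\<And>i. i \<in> {1..n} \<Longrightarrow> a i \<in> A i" by metis
  let ?t = "\<lambda>i\<in>{1..n}. {bot, a i}"
  have "?t \<in> (\<Pi>\<^sub>E i\<in>{1..n}. atomic_trees (A i))" using a by (auto simp: atomic_trees_def)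
  moreover have "supp n ?t = {1..n}"
    using a bot_notin_block by (fastforce simp: supp_def)
  ultimately have "\<rho> (f ?t) = card {1..n}" by (simp only: rank_f)
  then show ?thesis by auto
qed

text \<open>By the Moebius formula each atomic element contributes one signed monomial. Once the
  power \<open>m - n\<close> is factored out, the weights are those of
  \<open>sum_signed_supp\<close> for the full blocks.\<close>

lemma characteristic_poly_eq:
  assumes "n \<le> m"
  shows "characteristic_poly \<rho> m = monom 1 (m - n) * (\<Prod>i=1..n. [:- int (card (A i)), 1:])"
proof -
  let ?At = "\<Pi>\<^sub>E i\<in>{1..n}. atomic_trees (A i)"
  let ?X = "monom (1 :: int) 1"
  have "monom (mobius x) (m - \<rho> x) =
      (\<Sum>t\<in>{t \<in> ?At. f t = x}. monom ((-1) ^ card (supp n t)) (m - card (supp n t)))" for x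
  proof -
    have "monom (mobius x) (m - \<rho> x) =
        (\<Sum>t\<in>{t \<in> ?At. f t = x}. monom ((-1) ^ card (supp n t)) (m - \<rho> x))"
      by (simp add: mobius_eq signed_count monom_sum)
    also have "\<dots> = (\<Sum>t\<in>{t \<in> ?At. f t = x}. monom ((-1) ^ card (supp n t)) (m - card (supp n t)))"
      by (rule sum.cong) (auto simp: rank_f)
    finally show ?thesis .
  qed
  then have "characteristic_poly \<rho> m =
      (\<Sum>x\<in>UNIV. \<Sum>t\<in>{t \<in> ?At. f t = x}. monom ((-1) ^ card (supp n t)) (m - card (supp n t)))"
    by (simp add: characteristic_poly_def)
  also have "\<dots> = (\<Sum>t\<in>?At. monom ((-1) ^ card (supp n t)) (m - card (supp n t)))"
    using finite_atomic_trees by (intro sum.group) auto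
  also have "\<dots> = (\<Sum>t\<in>?At. monom 1 (m - n) * ((-1) ^ card (supp n t) * ?X ^ (n - card (supp n t))))"
  proof (rule sum.cong)
    fix t
    let ?k = "card (supp n t)"
    \<comment> \<open>Truncated subtraction is exact here, as
      \<open>?k \<le> n \<le> m\<close>.\<close>
    have "m - ?k = (m - n) + (n - ?k)" using assms card_supp_le[of n t] by simp
    then have "monom ((-1) ^ ?k) (m - ?k) = monom 1 (m - n) * monom ((-1 :: int) ^ ?k) (n - ?k)"
      by (simp add: mult_monom)
    \<comment> \<open>Parity turns the coefficient into 1 or -1, so that the sign can be moved out
      of \<open>monom\<close>.\<close>
    also have "monom ((-1 :: int) ^ ?k) (n - ?k) = (-1) ^ ?k * ?X ^ (n - ?k)"
      by (cases "even ?k") (simp_all add: monom_power minus_monom)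
    finally show "monom ((-1) ^ ?k) (m - ?k) = monom 1 (m - n) * ((-1) ^ ?k * ?X ^ (n - ?k))" .
  qed simp
  also have "\<dots> = monom 1 (m - n) * (\<Prod>i=1..n. ?X - of_nat (card (A i)))"
    using sum_signed_supp[of n A ?X] bot_notin_block by (simp add: sum_distrib_left[symmetric])
  also have "(\<lambda>i. ?X - of_nat (card (A i))) = (\<lambda>i. [:- int (card (A i)), 1:])"
    by (simp add: monom_altdef of_nat_poly)
  finally show ?thesis .
qed

end

theorem theorem11:
  fixes \<rho> :: "'a::{finite,order_bot} \<Rightarrow> nat"
    and m n :: nat
    and A :: "nat \<Rightarrow> 'a set"
    and f :: "(nat \<Rightarrow> 'a set) \<Rightarrow> 'a"
  assumes "\<forall>x. \<rho> x \<le> m"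
    and "ordered_partition atoms n A"
    and "complete_transversal n A f"
    and "\<forall>x. \<forall>t \<in> atomic_transversals n A f x. card (supp n t) = \<rho> x"
    and "\<forall>x. x \<noteq> bot \<longrightarrow> (\<exists>i\<in>{1..n}. card (A i \<inter> atoms_below x) = 1)"
  shows "order_isomorphic (UNIV :: 'a set) (\<le>)
           (tree_prod n A // ker_on (tree_prod n A) f) quotient_le \<and>
         (\<forall>x. mobius x = (-1) ^ \<rho> x * int (card (atomic_transversals n A f x))) \<and>
         n \<le> m \<and> characteristic_poly \<rho> m =
           monom 1 (m - n) * (\<Prod>i=1..n. [:- int (card (A i)), 1:])"
proof -
  interpret ranked_transversal n A f \<rho>
    using assms(2-5) by unfold_locales auto
  have "n \<le> m" using full_rank_exists assms(1) by metis
  then show ?thesis using quotient_isomorphic mobius_eq characteristic_poly_eq by blast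
qed

end
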